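(* Let $G = (N, (A_i)_{i\le N}, (\Theta_i)_{i\le N}, (u_i)_{i\le N}, T)$ be an incomplete information game with strict type uncertainty in which the set of agents, the action sets $A_i$ and the type sets $\Theta_i$ are all finite (and nonempty). Then $G$ has a minimax-regret equilibrium in mixed strategies, i.e. there exists a mixed strategy profile $\sigma = (\sigma_i)_{i \le N}$ such that for every agent $i$, $\sigma_i$ is a minimax best response to $\sigma_{-i}$ with respect to $T$.
   Context: An incomplete information game with strict type uncertainty consists of: agents $i = 1,\dots,N$; for each $i$ a set of actions $A_i$, a set of types $\Theta_i$, and a utility function $u_i : A \times \Theta_i \to \mathbb{R}$, where $A = \prod_i A_i$; and a strict prior $T \subseteq \Theta = \prod_i \Theta_i$ (a nonempty set, with no probability distribution on it). Write $\Theta_{-i} = \prod_{j\ne i}\Theta_j$. For $\theta_i \in \Theta_i$ let $T(\theta_i) = \{\theta_{-i} \in \Theta_{-i} : (\theta_i,\theta_{-i}) \in T\}$. A mixed strategy for agent $i$ is a map $\sigma_i : \Theta_i \to \Delta(A_i)$, where $\Delta(A_i)$ is the set of probability distributions on $A_i$. Let $\Sigma_i$ be the set of mixed strategies of $i$, and let $\Sigma_{-i} = \prod_{j \neq i} \Sigma_j$. For $\sigma_{-i} \in \Sigma_{-i}$ write $\sigma_{-i}(\theta_{-i}) = (\sigma_j(\theta_j))_{j \ne i}$. Utilities are extended to profiles of mixed actions by expectation, the agents randomizing independently. The regret of $\sigma_i$ for agent $i$ with type $\theta_i$, given $\sigma_{-i}$ and $\theta_{-i}$, is $$R_i(\sigma_i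 \mid \theta_i,\theta_{-i},\sigma_{-i}) = \max_{\sigma_i' \in \Sigma_i}\bigl[u_i(\langle\sigma_i'(\theta_i),\sigma_{-i}(\theta_{-i})\rangle,\theta_i) - u_i(\langle\sigma_i(\theta_i),\sigma_{-i}(\theta_{-i})\rangle,\theta_i)\bigr].$$ The max regret of $\sigma_i$ with respect to $T$, given $\theta_i$ and $\sigma_{-i}$, is $$MR_i(\sigma_i \mid \theta_i, T, \sigma_{-i}) = \max_{\theta_{-i} \in T(\theta_i)} R_i(\sigma_i \mid \theta_i,\theta_{-i},\sigma_{-i}),$$ with the convention that this is $0$ if $T(\theta_i) = \emptyset$. A minimax best response of agent $i$ to $\sigma_{-i}$ with respect to $T$ is a strategy $\sigma_i^* \in \Sigma_i$ such that for all $\theta_i \in \Theta_i$, $$\sigma_i^* \in \arg\min_{\sigma_i \in \Sigma_i} MR_i(\sigma_i \mid \theta_i, T, \sigma_{-i}).$$ A strategy profile $\sigma$ is a minimax-regret equilibrium iff $\sigma_i$ is a minimax best response to $\sigma_{-i}$ for all agents $i$. *)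

theory Defs
  imports "HOL-Probability.Product_PMF"
begin

record ('i, 'a, 't) game =
  agents :: "'i set"
  actions :: "'i \<Rightarrow> 'a set"
  type_space :: "'i \<Rightarrow> 't set"
  utility :: "'i \<Rightarrow> ('i \<Rightarrow> 'a) \<Rightarrow> 't \<Rightarrow> real"
  prior :: "('i \<Rightarrow> 't) set"

text \<open>Profiles over a set of agents are extensional functions on that set. Only the values of
  \<open>utility G i\<close> on agents \<open>i\<close>, action profiles in the product of the action sets, and types in
  \<open>type_space G i\<close> are relevant.\<close>

definition strict_type_game :: "('i, 'a, 't) game \<Rightarrow> bool" where
  "strict_type_game G \<longleftrightarrow> prior G \<noteq> {} \<and> prior G \<subseteq> PiE (agents G) (type_space G)"

definition finite_game :: "('i, 'a, 't) game \<Rightarrow> bool" where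
  "finite_game G \<longleftrightarrow>
     finite (agents G) \<and> agents G \<noteq> {} \<and>
     (\<forall>i\<in>agents G. finite (actions G i) \<and> actions G i \<noteq> {} \<and>
                    finite (type_space G i) \<and> type_space G i \<noteq> {})"

definition compatible_types :: "('i, 'a, 't) game \<Rightarrow> 'i \<Rightarrow> 't \<Rightarrow> ('i \<Rightarrow> 't) set" where
  "compatible_types G i t =
     {\<theta> \<in> PiE (agents G - {i}) (type_space G). \<theta>(i := t) \<in> prior G}"

definition mixed_actions :: "('i, 'a, 't) game \<Rightarrow> 'i \<Rightarrow> 'a pmf set" where
  "mixed_actions G i = {p. set_pmf p \<subseteq> actions G i}"

definition mixed_strategies :: "('i, 'a, 't) game \<Rightarrow> 'i \<Rightarrow> ('t \<Rightarrow> 'a pmf) set" where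
  "mixed_strategies G i = (type_space G i \<rightarrow>\<^sub>E mixed_actions G i)"

definition expected_utility ::
  "('i, 'a, 't) game \<Rightarrow> 'i \<Rightarrow> ('i \<Rightarrow> 'a pmf) \<Rightarrow> 't \<Rightarrow> real" where
  "expected_utility G i \<alpha> t =
     measure_pmf.expectation (Pi_pmf (agents G) undefined \<alpha>) (\<lambda>a. utility G i a t)"

text \<open>The mixed action profile in which agent \<open>i\<close> plays \<open>p\<close> and every other agent \<open>j\<close> plays
  \<open>\<sigma> j (\<theta> j)\<close>; here \<open>\<sigma>\<close> and \<open>\<theta>\<close> are profiles of the agents other than \<open>i\<close>.\<close>

definition play ::
  "('i, 'a, 't) game \<Rightarrow> 'i \<Rightarrow> 'a pmf \<Rightarrow> ('i \<Rightarrow> 't \<Rightarrow> 'a pmf) \<Rightarrow> ('i \<Rightarrow> 't) \<Rightarrow> ('i \<Rightarrow> 'a pmf)" where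
  "play G i p \<sigma> \<theta> = (\<lambda>j\<in>agents G - {i}. \<sigma> j (\<theta> j))(i := p)"

text \<open>The two maxima below are rendered as suprema. In a finite game they are attained: in
  \<open>regret\<close>, the expectation is affine in \<open>s' t\<close>, which ranges over a simplex; in \<open>max_regret\<close>,
  the index set is finite.\<close>

definition regret ::
  "('i, 'a, 't) game \<Rightarrow> 'i \<Rightarrow> ('t \<Rightarrow> 'a pmf) \<Rightarrow> 't \<Rightarrow> ('i \<Rightarrow> 't) \<Rightarrow> ('i \<Rightarrow> 't \<Rightarrow> 'a pmf) \<Rightarrow> real" where
  "regret G i s t \<theta> \<sigma> =
     (SUP s' \<in> mixed_strategies G i.
        expected_utility G i (play G i (s' t) \<sigma> \<theta>) t - expected_utility G i (play G i (s t) \<sigma> \<theta>) t)"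

definition max_regret ::
  "('i, 'a, 't) game \<Rightarrow> 'i \<Rightarrow> ('t \<Rightarrow> 'a pmf) \<Rightarrow> 't \<Rightarrow> ('i \<Rightarrow> 't \<Rightarrow> 'a pmf) \<Rightarrow> real" where
  "max_regret G i s t \<sigma> =
     (if compatible_types G i t = {} then 0
      else (SUP \<theta> \<in> compatible_types G i t. regret G i s t \<theta> \<sigma>))"

definition minimax_best_response ::
  "('i, 'a, 't) game \<Rightarrow> 'i \<Rightarrow> ('t \<Rightarrow> 'a pmf) \<Rightarrow> ('i \<Rightarrow> 't \<Rightarrow> 'a pmf) \<Rightarrow> bool" where
  "minimax_best_response G i s \<sigma> \<longleftrightarrow>
     s \<in> mixed_strategies G i \<and>
     (\<forall>t\<in>type_space G i.
        is_arg_min (\<lambda>s'. max_regret G i s' t \<sigma>) (\<lambda>s'. s' \<in> mixed_strategies G i) s)"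

definition minimax_regret_equilibrium ::
  "('i, 'a, 't) game \<Rightarrow> ('i \<Rightarrow> 't \<Rightarrow> 'a pmf) \<Rightarrow> bool" where
  "minimax_regret_equilibrium G \<sigma> \<longleftrightarrow>
     \<sigma> \<in> PiE (agents G) (mixed_strategies G) \<and>
     (\<forall>i\<in>agents G. minimax_best_response G i (\<sigma> i) (restrict \<sigma> (agents G - {i})))"

end

theory Submission
  imports Defs "HOL-Analysis.Brouwer_Fixpoint" "HOL-Analysis.Function_Metric"
begin

text \<open>Write \<open>m i t x y\<close> for the max regret of agent \<open>i\<close> of type \<open>t\<close> who plays according to \<open>y\<close>
  against \<open>x\<close>. It is a finite maximum of differences between the best pure payoff, which depends
  only on \<open>x\<close>, and the payoff of \<open>y\<close>, which is linear in \<open>y\<close>; so it is continuous, and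
  convex in \<open>y\<close>. Hence \<open>\<phi> x y = (\<Sum>i t. m i t x x - m i t x y)\<close> is continuous in \<open>x\<close>, concave
  in \<open>y\<close> and zero on the diagonal, and Ky Fan's inequality yields \<open>x\<close> with \<open>\<phi> x y \<le> 0\<close> for
  all \<open>y\<close>. Comparing with those \<open>y\<close> that change \<open>x\<close> for a single agent and type shows that
  \<open>x\<close> is an equilibrium.\<close>

section \<open>Ky Fan's inequality in a product of real lines\<close>

text \<open>Tychonoff. The index type is arbitrary, so vectors may carry coordinates beyond the
  finitely many that matter, provided these are bounded as well.\<close>

lemma compact_cube_fun: "compact {x :: 'k \<Rightarrow> real. \<forall>k. x k \<in> {0..1}}"
proof -
  have "compactin (product_topology (\<lambda>_. euclidean) UNIV) (PiE UNIV (\<lambda>_::'k. {0..1::real}))"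
    by (subst compactin_PiE) auto
  moreover have "PiE UNIV (\<lambda>_::'k. {0..1::real}) = {x. \<forall>k. x k \<in> {0..1}}"
    by (auto simp: PiE_iff)
  ultimately show ?thesis
    by (simp add: euclidean_product_topology)
qed

text \<open>Squeeze: the mesh \<open>1 / Suc (f m)\<close> tends to 0, so moving by at most one grid
  step keeps the limit. It makes all corners of a shrinking grid cell converge to one point.\<close>

lemma tendsto_between_Suc_over:
  fixes q r :: "nat \<Rightarrow> nat" and f :: "nat \<Rightarrow> nat"
  assumes "(\<lambda>m. real (q m) / real (Suc (f m))) \<longlonglongrightarrow> l"
    and "\<And>m. q m \<le> r m" "\<And>m. r m \<le> q m + 1" and "strict_mono f"
  shows "(\<lambda>m. real (r m) / real (Suc (f m))) \<longlonglongrightarrow> l"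
proof -
  have lim: "(\<lambda>m. 1 / real (Suc (f m))) \<longlonglongrightarrow> 0"
    using LIMSEQ_subseq_LIMSEQ[OF LIMSEQ_inverse_real_of_nat \<open>strict_mono f\<close>]
    by (simp add: o_def inverse_eq_divide)
  have upper: "(\<lambda>m. real (q m) / real (Suc (f m)) + 1 / real (Suc (f m))) \<longlonglongrightarrow> l"
    using tendsto_add[OF assms(1) lim] by simp
  show ?thesis
  proof (rule tendsto_sandwich[OF _ _ assms(1) upper]; intro always_eventually allI)
    fix m
    show "real (q m) / real (Suc (f m)) \<le> real (r m) / real (Suc (f m))"
      using assms(2)[of m] by (intro divide_right_mono) auto
    show "real (r m) / real (Suc (f m)) \<le> real (q m) / real (Suc (f m)) + 1 / real (Suc (f m))"
      unfolding add_divide_distrib[symmetric] using assms(3)[of m]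
      by (intro divide_right_mono) linarith+
  qed
qed

text \<open>The type-based \<open>brouwer\<close> needs the dimension as a type. Here the dimension \<open>n\<close> is a
  term, so the theorem is derived again from Kuhn's lemma.\<close>

proposition brouwer_cube_fun:
  fixes F :: "nat \<Rightarrow> (nat \<Rightarrow> real) \<Rightarrow> real"
  defines "Q \<equiv> {x :: nat \<Rightarrow> real. \<forall>k. x k \<in> {0..1}}"
  assumes cont: "\<And>i. i < n \<Longrightarrow> continuous_on Q (F i)"
    and range: "\<And>i x. i < n \<Longrightarrow> x \<in> Q \<Longrightarrow> F i x \<in> {0..1}"
  obtains x where "x \<in> Q" "\<And>i. i < n \<Longrightarrow> F i x = x i"
proof -
  \<comment> \<open>Grid point of mesh \<open>1 / Suc p\<close>. Coordinates from \<open>n\<close>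
    on are set to 0, which keeps the point in \<open>Q\<close> and makes these coordinates converge
    trivially.\<close>
  define pt where "pt p x = (\<lambda>i. if i < n then real (x i) / real (Suc p) else 0)" for p and x :: "nat \<Rightarrow> nat"
  have pt_Q: "pt p x \<in> Q" if "\<And>i. i < n \<Longrightarrow> x i \<le> Suc p" for p x
  proof -
    have "real (x i) / real (Suc p) \<in> {0..1}" if "i < n" for i
      using of_nat_mono[OF \<open>\<And>i. i < n \<Longrightarrow> x i \<le> Suc p\<close>[OF that], where 'a = real]
      by (simp add: divide_simps)
    then show ?thesis
      unfolding pt_def Q_def by simp
  qed
  \<comment> \<open>Every grid has a cell in which, for each \<open>i < n\<close>, two corners have
    displacements in coordinate \<open>i\<close> of opposite sign, possibly zero. Stated as a
    product, this passes to the limit.\<close>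
  have "\<exists>q. (\<forall>i<n. q i < Suc p) \<and> (\<forall>i<n. \<exists>r s. (\<forall>j<n. q j \<le> r j \<and> r j \<le> q j + 1) \<and>
      (\<forall>j<n. q j \<le> s j \<and> s j \<le> q j + 1) \<and>
      (F i (pt p r) - pt p r i) * (F i (pt p s) - pt p s i) \<le> 0)" for p
  proof -
    \<comment> \<open>Label 1 where \<open>F i\<close> does not increase coordinate
      \<open>i\<close>, label 0 where it does not decrease it. Kuhn's lemma prescribes 1 at
      \<open>Suc p\<close> and 0 at 0; there the sign is right because \<open>F i\<close> maps into
      \<open>{0..1}\<close>.\<close>
    define label where "label x i =
      (if x i = Suc p \<or> (x i \<noteq> 0 \<and> F i (pt p x) < pt p x i) then 1 else 0 :: nat)" for x i
    have label_1: "F i (pt p x) - pt p x i \<le> 0" if "i < n" "\<And>i. i < n \<Longrightarrow> x i \<le> Suc p" "label x i = 1" for x i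
    proof (cases "x i = Suc p")
      case True
      then show ?thesis using range[OF \<open>i < n\<close> pt_Q[of x p]] that by (auto simp: pt_def)
    qed (use that in \<open>auto simp: label_def split: if_splits\<close>)
    have label_0: "F i (pt p x) - pt p x i \<ge> 0" if "i < n" "\<And>i. i < n \<Longrightarrow> x i \<le> Suc p" "label x i = 0" for x i
    proof (cases "x i = 0")
      case True
      then show ?thesis using range[OF \<open>i < n\<close> pt_Q[of x p]] that by (auto simp: pt_def)
    qed (use that in \<open>auto simp: label_def split: if_splits\<close>)
    obtain q where q: "\<forall>i<n. q i < Suc p"
      "\<forall>i<n. \<exists>r s. (\<forall>j<n. q j \<le> r j \<and> r j \<le> q j + 1) \<and>
        (\<forall>j<n. q j \<le> s j \<and> s j \<le> q j + 1) \<and> label r i \<noteq> label s i"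
      by (rule kuhn_lemma[of "Suc p" n label]) (auto simp: label_def)
    have "\<exists>r s. (\<forall>j<n. q j \<le> r j \<and> r j \<le> q j + 1) \<and> (\<forall>j<n. q j \<le> s j \<and> s j \<le> q j + 1) \<and>
      (F i (pt p r) - pt p r i) * (F i (pt p s) - pt p s i) \<le> 0" if "i < n" for i
    proof -
      obtain r s where rs: "\<forall>j<n. q j \<le> r j \<and> r j \<le> q j + 1" "\<forall>j<n. q j \<le> s j \<and> s j \<le> q j + 1"
        "label r i \<noteq> label s i"
        using q(2) \<open>i < n\<close> by blast
      have le: "r j \<le> Suc p" "s j \<le> Suc p" if "j < n" for j
        using rs(1,2) q(1) that by (metis Suc_eq_plus1 Suc_leI le_trans)+
      have "label r i = 0 \<and> label s i = 1 \<or> label r i = 1 \<and> label s i = 0"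
        using rs(3) by (auto simp: label_def split: if_splits)
      then have "(F i (pt p r) - pt p r i) * (F i (pt p s) - pt p s i) \<le> 0"
        using label_0[OF that, of r] label_0[OF that, of s] label_1[OF that, of r] label_1[OF that, of s] le
        by (auto intro: mult_nonneg_nonpos mult_nonpos_nonneg)
      with rs show ?thesis by blast
    qed
    with q(1) show ?thesis by blast
  qed
  then obtain q where q: "\<And>p i. i < n \<Longrightarrow> q p i < Suc p"
    and ex: "\<And>p. \<forall>i<n. \<exists>r s. (\<forall>j<n. q p j \<le> r j \<and> r j \<le> q p j + 1) \<and>
      (\<forall>j<n. q p j \<le> s j \<and> s j \<le> q p j + 1) \<and>
      (F i (pt p r) - pt p r i) * (F i (pt p s) - pt p s i) \<le> 0"
    by metis
  then obtain r s where r: "\<And>p i j. i < n \<Longrightarrow> j < n \<Longrightarrow> q p j \<le> r p i j \<and> r p i j \<le> q p j + 1"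
    and s: "\<And>p i j. i < n \<Longrightarrow> j < n \<Longrightarrow> q p j \<le> s p i j \<and> s p i j \<le> q p j + 1"
    and rs: "\<And>p i. i < n \<Longrightarrow>
      (F i (pt p (r p i)) - pt p (r p i) i) * (F i (pt p (s p i)) - pt p (s p i) i) \<le> 0"
    by metis
  \<comment> \<open>The index type \<open>nat\<close> is countable, so compactness of the cube
    yields convergent subsequences.\<close>
  have "seq_compact Q"
    unfolding Q_def by (intro compact_imp_seq_compact compact_cube_fun)
  moreover have "\<forall>p. pt p (q p) \<in> Q"
    using pt_Q q less_imp_le by blast
  ultimately obtain x f where x: "x \<in> Q" and f: "strict_mono f"
    and lim: "((\<lambda>p. pt p (q p)) \<circ> f) \<longlonglongrightarrow> x"
    unfolding seq_compact_def by metis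
  have lim_coord: "(\<lambda>m. pt (f m) (q (f m)) j) \<longlonglongrightarrow> x j" for j
    using continuous_on_tendsto_compose[OF continuous_on_product_coordinates[of j] lim] by (simp add: o_def)
  have near: "(\<lambda>m. pt (f m) (y m)) \<longlonglongrightarrow> x"
    if y: "\<And>m j. j < n \<Longrightarrow> q (f m) j \<le> y m j \<and> y m j \<le> q (f m) j + 1" for y
  proof -
    have "(\<lambda>m. pt (f m) (y m) j) \<longlonglongrightarrow> x j" for j
    proof (cases "j < n")
      case True
      then have "(\<lambda>m. real (q (f m) j) / real (Suc (f m))) \<longlonglongrightarrow> x j"
        using lim_coord[of j] by (simp only: pt_def if_True)
      then have "(\<lambda>m. real (y m j) / real (Suc (f m))) \<longlonglongrightarrow> x j"
        by (rule tendsto_between_Suc_over[where q = "\<lambda>m. q (f m) j"]) (use y[OF True] f in auto)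
      with True show ?thesis by (simp only: pt_def if_True)
    next
      case False
      with lim_coord[of j] show ?thesis by (simp add: pt_def)
    qed
    then show ?thesis
      using limitin_componentwise[of "\<lambda>_. euclidean" UNIV "\<lambda>m. pt (f m) (y m)" x sequentially]
      by (simp add: euclidean_product_topology)
  qed
  have "F i x = x i" if "i < n" for i
  proof -
    have lim_F: "(\<lambda>m. F i (pt (f m) (y m)) - pt (f m) (y m) i) \<longlonglongrightarrow> F i x - x i"
      if y: "\<And>m j. j < n \<Longrightarrow> q (f m) j \<le> y m j \<and> y m j \<le> q (f m) j + 1" for y
    proof (intro tendsto_diff)
      have "pt (f m) (y m) \<in> Q" for m
        using y q by (intro pt_Q) (metis Suc_eq_plus1 Suc_leI le_trans not_less_eq_eq)
      then show "(\<lambda>m. F i (pt (f m) (y m))) \<longlonglongrightarrow> F i x"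
        using continuous_on_tendsto_compose[OF cont[OF \<open>i < n\<close>] near[OF y] x] by simp
      show "(\<lambda>m. pt (f m) (y m) i) \<longlonglongrightarrow> x i"
        using continuous_on_tendsto_compose[OF continuous_on_product_coordinates[of i] near[OF y]] by simp
    qed
    \<comment> \<open>Both corners converge to \<open>x\<close>, so the product of their
      displacements, at most 0, tends to the square of the displacement at \<open>x\<close>.\<close>
    have "(F i x - x i) * (F i x - x i) \<le> 0"
      by (rule LIMSEQ_le_const2[OF tendsto_mult[OF lim_F[of "\<lambda>m. r (f m) i"] lim_F[of "\<lambda>m. s (f m) i"]]])
        (use r s rs that in auto)
    then show ?thesis
      by (metis eq_iff_diff_eq_0 mult_eq_0_iff not_square_less_zero order_le_less)
  qed
  with x that show thesis by blast
qed

text \<open>Otherwise, replacing the weights \<open>l\<close> of the point \<open>p l\<close> by weights proportional to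
  the positive part of \<open>\<phi> (p l) (y k)\<close> gives a continuous map of weights, and at a fixed point
  concavity forces \<open>\<phi> (p l) (p l) > 0\<close>.\<close>

lemma Ky_Fan_finite:
  fixes K :: "('k \<Rightarrow> real) set" and \<phi> :: "('k \<Rightarrow> real) \<Rightarrow> ('k \<Rightarrow> real) \<Rightarrow> real" and y :: "nat \<Rightarrow> 'k \<Rightarrow> real"
  assumes y: "\<And>k. k < n \<Longrightarrow> y k \<in> K" and n: "n > 0"
    and convex: "\<And>c. (\<And>k. k < n \<Longrightarrow> 0 \<le> c k) \<Longrightarrow> sum c {..<n} = 1 \<Longrightarrow>
      (\<lambda>j. \<Sum>k<n. c k * y k j) \<in> K"
    and concave: "\<And>c x. x \<in> K \<Longrightarrow> (\<And>k. k < n \<Longrightarrow> 0 \<le> c k) \<Longrightarrow> sum c {..<n} = 1 \<Longrightarrow>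
      (\<Sum>k<n. c k * \<phi> x (y k)) \<le> \<phi> x (\<lambda>j. \<Sum>k<n. c k * y k j)"
    and cont: "\<And>k. k < n \<Longrightarrow> continuous_on K (\<lambda>x. \<phi> x (y k))"
    and diag: "\<And>x. x \<in> K \<Longrightarrow> \<phi> x x \<le> 0"
  shows "\<exists>x\<in>K. \<forall>k<n. \<phi> x (y k) \<le> 0"
proof (rule ccontr)
  assume contra: "\<not> ?thesis"
  define Q where "Q = {l :: nat \<Rightarrow> real. \<forall>k. l k \<in> {0..1}}"
  define S where "S l = sum l {..<n}" for l :: "nat \<Rightarrow> real"
  \<comment> \<open>\<open>\<rho>\<close> retracts the cube onto the standard simplex, so that Brouwer on the cube suffices.\<close>
  define \<rho> where "\<rho> l k = (l k + (if k = 0 then max 0 (1 - S l) else 0)) / max 1 (S l)" for l k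
  define p where "p l = (\<lambda>j. \<Sum>k<n. \<rho> l k * y k j)" for l
  define g where "g k l = max 0 (\<phi> (p l) (y k))" for k l
  define H where "H l = (\<Sum>k<n. g k l)" for l
  have \<rho>_nonneg: "0 \<le> \<rho> l k" if "l \<in> Q" for l k
    using that by (auto simp: \<rho>_def Q_def)
  have \<rho>_sum: "sum (\<rho> l) {..<n} = 1" for l
  proof -
    have "(\<Sum>k<n. l k + (if k = 0 then max 0 (1 - S l) else 0)) = max 1 (S l)"
      using n by (simp add: sum.distrib S_def max_def)
    then show ?thesis by (simp add: \<rho>_def sum_divide_distrib[symmetric])
  qed
  have p_K: "p l \<in> K" if "l \<in> Q" for l
    unfolding p_def by (intro convex \<rho>_nonneg \<rho>_sum that)
  have cont_coord: "continuous_on Q (\<lambda>l. l k)" for k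
    by (rule continuous_on_subset[OF continuous_on_product_coordinates subset_UNIV])
  have cont_S: "continuous_on Q S"
    unfolding S_def by (intro continuous_on_sum cont_coord)
  have cont_max: "continuous_on Q (\<lambda>l. max 0 (1 - S l))"
    by (intro continuous_intros cont_S)
  have "continuous_on Q (\<lambda>l. \<rho> l k)" for k
  proof -
    have "continuous_on Q (\<lambda>l. l k + (if k = 0 then max 0 (1 - S l) else 0))"
      using continuous_on_add[OF cont_coord cont_max] cont_coord by (cases "k = 0") auto
    then show ?thesis
      unfolding \<rho>_def
      by (rule continuous_on_divide[OF _ continuous_on_max[OF continuous_on_const cont_S]]) (simp add: max_def)
  qed
  then have "continuous_on Q (\<lambda>l. \<Sum>k<n. \<rho> l k * y k j)" for j
    by (intro continuous_on_sum continuous_on_mult_right) blast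
  then have cont_p: "continuous_on Q p"
    unfolding p_def by (rule continuous_on_coordinatewise_then_product)
  have cont_g: "continuous_on Q (g k)" if "k < n" for k
    unfolding g_def
    by (intro continuous_intros continuous_on_compose2[OF cont[OF that] cont_p]) (auto simp: p_K)
  have g_nonneg: "0 \<le> g k l" for k l by (simp add: g_def)
  \<comment> \<open>The assumed failure of the claim at \<open>p l\<close> is what permits
    normalising by \<open>H l\<close>.\<close>
  have H_pos: "H l > 0" if l: "l \<in> Q" for l
  proof -
    obtain k where "k < n" "\<phi> (p l) (y k) > 0"
      using contra p_K[OF l] by force
    then have "k < n" "g k l > 0" by (auto simp: g_def)
    then show ?thesis
      unfolding H_def using g_nonneg by (intro sum_pos2[of _ k]) auto
  qed
  have cont_F: "continuous_on Q (\<lambda>l. g k l / H l)" if "k < n" for k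
  proof (rule continuous_on_divide[OF cont_g[OF that]])
    show "continuous_on Q H"
      unfolding H_def using cont_g by (intro continuous_on_sum) auto
    show "\<forall>l\<in>Q. H l \<noteq> 0"
      using H_pos by force
  qed
  have range_F: "g k l / H l \<in> {0..1}" if "k < n" "l \<in> Q" for k l
  proof -
    have "g k l \<le> H l"
      unfolding H_def using that g_nonneg by (intro member_le_sum) auto
    then show ?thesis using g_nonneg[of k l] H_pos[OF that(2)] by simp
  qed
  obtain l where l: "l \<in> Q" and fp: "\<And>k. k < n \<Longrightarrow> g k l / H l = l k"
    using brouwer_cube_fun[of n "\<lambda>k l. g k l / H l"] cont_F range_F unfolding Q_def by blast
  \<comment> \<open>At the fixed point the first \<open>n\<close> coordinates sum to 1, so
    \<open>\<rho>\<close> leaves them unchanged: the weights of \<open>p l\<close> are themselves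
    proportional to the positive parts.\<close>
  have "S l = (\<Sum>k<n. g k l / H l)" by (simp add: S_def fp)
  also have "\<dots> = 1" using H_pos[OF l] by (simp add: sum_divide_distrib[symmetric] H_def[symmetric])
  finally have S: "S l = 1" .
  have \<rho>: "\<rho> l k = g k l / H l" if "k < n" for k
    using S fp[OF that] by (simp add: \<rho>_def)
  obtain k where k: "k < n" "\<phi> (p l) (y k) > 0"
    using contra p_K[OF l] by force
  \<comment> \<open>A weight vanishes wherever \<open>\<phi> (p l) (y k) \<le> 0\<close>, so no
    summand is negative.\<close>
  have "(\<Sum>k<n. \<rho> l k * \<phi> (p l) (y k)) > 0"
  proof (rule sum_pos2[of _ k])
    show "0 < \<rho> l k * \<phi> (p l) (y k)"
      using k H_pos[OF l] by (simp add: \<rho> g_def)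
    show "0 \<le> \<rho> l k * \<phi> (p l) (y k)" if "k \<in> {..<n}" for k
      using that H_pos[OF l] by (auto simp: \<rho> g_def max_def)
  qed (use k in auto)
  also have "\<dots> \<le> \<phi> (p l) (p l)"
    using concave[OF p_K[OF l] \<rho>_nonneg[OF l] \<rho>_sum] by (simp add: p_def)
  finally show False using diag[OF p_K[OF l]] by simp
qed

text \<open>\<open>Ky_Fan_finite\<close> gives the finite intersection property for the closed sets
  \<open>{x \<in> K. \<phi> x y \<le> 0}\<close>, and compactness of \<open>K\<close> yields a
  common point.\<close>

theorem Ky_Fan:
  fixes K :: "('k \<Rightarrow> real) set" and \<phi> :: "('k \<Rightarrow> real) \<Rightarrow> ('k \<Rightarrow> real) \<Rightarrow> real"
  assumes K: "compact K" "K \<noteq> {}"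
    and convex: "\<And>(n::nat) c y. (\<And>k. k < n \<Longrightarrow> y k \<in> K) \<Longrightarrow> (\<And>k. k < n \<Longrightarrow> 0 \<le> c k) \<Longrightarrow>
      sum c {..<n} = 1 \<Longrightarrow> (\<lambda>j. \<Sum>k<n. c k * y k j) \<in> K"
    and concave: "\<And>(n::nat) c y x. x \<in> K \<Longrightarrow> (\<And>k. k < n \<Longrightarrow> y k \<in> K) \<Longrightarrow> (\<And>k. k < n \<Longrightarrow> 0 \<le> c k) \<Longrightarrow>
      sum c {..<n} = 1 \<Longrightarrow> (\<Sum>k<n. c k * \<phi> x (y k)) \<le> \<phi> x (\<lambda>j. \<Sum>k<n. c k * y k j)"
    and cont: "\<And>y. y \<in> K \<Longrightarrow> continuous_on K (\<lambda>x. \<phi> x y)"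
    and diag: "\<And>x. x \<in> K \<Longrightarrow> \<phi> x x \<le> 0"
  shows "\<exists>x\<in>K. \<forall>y\<in>K. \<phi> x y \<le> 0"
proof -
  \<comment> \<open>Compact sets are closed in a Hausdorff space. With \<open>K\<close> closed,
    sublevel sets of a function continuous only on \<open>K\<close> are closed in the whole
    space.\<close>
  have "Hausdorff_space (product_topology (\<lambda>_::'k. euclidean :: real topology) UNIV)"
    by (simp add: Hausdorff_space_product_topology)
  then have "closed K"
    using compactin_imp_closedin[of "product_topology (\<lambda>_. euclidean) UNIV" K] K(1)
    by (simp add: euclidean_product_topology)
  then have closed: "closed {x \<in> K. \<phi> x y \<le> 0}" if "y \<in> K" for y
    using continuous_on_closed_Collect_le[OF cont[OF that] continuous_on_const] by blast
  have "K \<inter> (\<Inter>y\<in>K. {x \<in> K. \<phi> x y \<le> 0}) \<noteq> {}"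
  proof (rule compact_imp_fip_image[OF K(1) closed])
    fix Y assume Y: "finite Y" "Y \<subseteq> K"
    show "K \<inter> (\<Inter>y\<in>Y. {x \<in> K. \<phi> x y \<le> 0}) \<noteq> {}"
    proof (cases "Y = {}")
      case False
      obtain y and n :: nat where Y_eq: "Y = y ` {..<n}"
        using finite_imp_nat_seg_image_inj_on[OF Y(1)] by (auto simp: lessThan_def)
      have y: "y k \<in> K" if "k < n" for k
        using Y Y_eq that by auto
      have "n > 0"
        using False Y_eq by (cases n) auto
      then have "\<exists>x\<in>K. \<forall>k<n. \<phi> x (y k) \<le> 0"
        using y convex[of n y] concave[of _ n y] cont diag by (intro Ky_Fan_finite) auto
      then show ?thesis unfolding Y_eq by auto
    qed (use K in auto)
  qed
  then show ?thesis by auto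
qed

lemma continuous_on_Max_image:
  fixes f :: "'k \<Rightarrow> 'x::topological_space \<Rightarrow> real"
  assumes "finite I" "I \<noteq> {}" "\<And>k. k \<in> I \<Longrightarrow> continuous_on S (f k)"
  shows "continuous_on S (\<lambda>x. Max ((\<lambda>k. f k x) ` I))"
  using assms
proof (induction rule: finite_ne_induct)
  case (insert k I)
  then have "continuous_on S (\<lambda>x. max (f k x) (Max ((\<lambda>k. f k x) ` I)))"
    by (intro continuous_on_max) auto
  with insert show ?case by simp
qed auto

section \<open>Max regret in coordinates\<close>

text \<open>A profile of mixed strategies is encoded by the real vector \<open>x\<close> whose entry \<open>x (i, t, a)\<close>
  is the probability with which agent \<open>i\<close> of type \<open>t\<close> plays \<open>a\<close>.\<close>

definition strategy_vectors :: "('i, 'a, 't) game \<Rightarrow> ('i \<times> 't \<times> 'a \<Rightarrow> real) set" where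
  "strategy_vectors G = {x. (\<forall>k. x k \<in> {0..1}) \<and>
     (\<forall>i\<in>agents G. \<forall>t\<in>type_space G i. (\<Sum>a\<in>actions G i. x (i, t, a)) = 1)}"

text \<open>Entries at actions outside \<open>actions G i\<close> are constrained only to
  \<open>{0..1}\<close> in \<open>strategy_vectors G\<close>, hence cut off before
  \<open>embed_pmf\<close>.\<close>

definition strategy_profile :: "('i, 'a, 't) game \<Rightarrow> ('i \<times> 't \<times> 'a \<Rightarrow> real) \<Rightarrow> 'i \<Rightarrow> 't \<Rightarrow> 'a pmf" where
  "strategy_profile G x = (\<lambda>i\<in>agents G. \<lambda>t\<in>type_space G i.
     embed_pmf (\<lambda>a. if a \<in> actions G i then x (i, t, a) else 0))"

text \<open>Expected payoff of the pure action \<open>b\<close> when the opponents, of types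
  \<open>\<theta>\<close>, mix independently according to \<open>x\<close>. Profiles are
  \<open>undefined\<close> off the agents, matching the \<open>Pi_pmf\<close> in
  \<open>expected_utility\<close>.\<close>

definition pure_payoff ::
  "('i, 'a, 't) game \<Rightarrow> 'i \<Rightarrow> 't \<Rightarrow> ('i \<times> 't \<times> 'a \<Rightarrow> real) \<Rightarrow> ('i \<Rightarrow> 't) \<Rightarrow> 'a \<Rightarrow> real" where
  "pure_payoff G i t x \<theta> b =
     (\<Sum>f | f \<in> PiE_dflt (agents G) undefined (actions G) \<and> f i = b.
        (\<Prod>j\<in>agents G - {i}. x (j, \<theta> j, f j)) * utility G i f t)"

text \<open>Opponents play \<open>x\<close>, the agent plays \<open>y\<close>; these become the two
  arguments in Ky Fan's inequality. By linearity the maximum over pure actions equals the one over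
  mixed actions.\<close>

definition regret_vec ::
  "('i, 'a, 't) game \<Rightarrow> 'i \<Rightarrow> 't \<Rightarrow> ('i \<times> 't \<times> 'a \<Rightarrow> real) \<Rightarrow> ('i \<times> 't \<times> 'a \<Rightarrow> real) \<Rightarrow> ('i \<Rightarrow> 't) \<Rightarrow> real" where
  "regret_vec G i t x y \<theta> =
     Max (pure_payoff G i t x \<theta> ` actions G i) - (\<Sum>b\<in>actions G i. y (i, t, b) * pure_payoff G i t x \<theta> b)"

definition max_regret_vec ::
  "('i, 'a, 't) game \<Rightarrow> 'i \<Rightarrow> 't \<Rightarrow> ('i \<times> 't \<times> 'a \<Rightarrow> real) \<Rightarrow> ('i \<times> 't \<times> 'a \<Rightarrow> real) \<Rightarrow> real" where
  "max_regret_vec G i t x y =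
     (if compatible_types G i t = {} then 0
      else Max (regret_vec G i t x y ` compatible_types G i t))"

lemma strategy_vectors_nonneg: "x \<in> strategy_vectors G \<Longrightarrow> 0 \<le> x k"
  and strategy_vectors_le_1: "x \<in> strategy_vectors G \<Longrightarrow> x k \<le> 1"
  unfolding strategy_vectors_def mem_Collect_eq atLeastAtMost_iff by blast+

text \<open>Used to cancel the terms of all other agents and types when a deviation concerns just
  one.\<close>

lemma max_regret_vec_cong:
  assumes "\<And>b. b \<in> actions G i \<Longrightarrow> y (i, t, b) = z (i, t, b)"
  shows "max_regret_vec G i t x y = max_regret_vec G i t x z"
proof -
  have "regret_vec G i t x y = regret_vec G i t x z"
    using assms by (auto simp: regret_vec_def fun_eq_iff intro!: sum.cong)
  then show ?thesis by (simp add: max_regret_vec_def)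
qed

section \<open>Payoffs and regrets of encoded profiles\<close>

context
  fixes G :: "('i, 'a, 't) game"
  assumes finite_game: "finite_game G"
begin

lemma finite_agents: "finite (agents G)"
  and finite_actions: "i \<in> agents G \<Longrightarrow> finite (actions G i)"
  and actions_nonempty: "i \<in> agents G \<Longrightarrow> actions G i \<noteq> {}"
  and finite_types: "i \<in> agents G \<Longrightarrow> finite (type_space G i)"
  using finite_game by (auto simp: finite_game_def)

lemma finite_pure_profiles: "finite (PiE_dflt (agents G) undefined (actions G))"
  using finite_agents finite_actions by (intro finite_PiE_dflt)

lemma finite_compatible_types: "finite (compatible_types G i t)"
  unfolding compatible_types_def
  by (rule finite_subset[OF _ finite_PiE[of "agents G - {i}" "type_space G"]])
    (auto simp: finite_agents finite_types)

lemma pmf_strategy_profile: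
  assumes "x \<in> strategy_vectors G" "i \<in> agents G" "t \<in> type_space G i"
  shows "pmf (strategy_profile G x i t) a = (if a \<in> actions G i then x (i, t, a) else 0)"
proof -
  note nonneg = strategy_vectors_nonneg[OF assms(1)]
  have "(\<integral>\<^sup>+ a. ennreal (if a \<in> actions G i then x (i, t, a) else 0) \<partial>count_space UNIV) =
      (\<Sum>a\<in>actions G i. ennreal (x (i, t, a)))"
    by (subst nn_integral_count_space'[of "actions G i"]) (auto simp: finite_actions assms)
  also have "\<dots> = 1"
    using assms nonneg by (subst sum_ennreal) (auto simp: strategy_vectors_def)
  finally show ?thesis
    using assms nonneg by (simp add: strategy_profile_def pmf_embed_pmf)
qed

lemma strategy_profile_mixed:
  assumes "x \<in> strategy_vectors G"
  shows "strategy_profile G x \<in> PiE (agents G) (mixed_strategies G)"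
proof -
  have "strategy_profile G x i t \<in> mixed_actions G i" if "i \<in> agents G" "t \<in> type_space G i" for i t
    using pmf_strategy_profile[OF assms that] by (auto simp: mixed_actions_def set_pmf_eq split: if_splits)
  then show ?thesis
    by (auto simp: mixed_strategies_def PiE_iff strategy_profile_def)
qed

text \<open>By independence the probability of a pure profile splits into the factor of agent
  \<open>i\<close> and the product over the opponents; grouping the profiles by the action of
  \<open>i\<close> exposes linearity in \<open>p\<close>.\<close>

lemma expected_utility_strategy_profile:
  assumes x: "x \<in> strategy_vectors G" and i: "i \<in> agents G" and p: "p \<in> mixed_actions G i"
    and \<theta>: "\<theta> \<in> PiE (agents G - {i}) (type_space G)"
  shows "expected_utility G i (play G i p (restrict (strategy_profile G x) (agents G - {i})) \<theta>) t =
    (\<Sum>b\<in>actions G i. pmf p b * pure_payoff G i t x \<theta> b)"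
proof -
  let ?\<alpha> = "play G i p (restrict (strategy_profile G x) (agents G - {i})) \<theta>"
  let ?P = "PiE_dflt (agents G) undefined (actions G)"
  have \<alpha>: "?\<alpha> j = strategy_profile G x j (\<theta> j)" if "j \<in> agents G - {i}" for j
    using that by (auto simp: play_def)
  have \<alpha>_i: "?\<alpha> i = p" by (simp add: play_def)
  have "set_pmf (?\<alpha> j) \<subseteq> actions G j" if "j \<in> agents G" for j
  proof (cases "j = i")
    case False
    with that \<theta> show ?thesis
      using strategy_profile_mixed[OF x] \<alpha>[of j]
      by (auto simp: mixed_strategies_def mixed_actions_def PiE_iff)
  qed (use p \<alpha>_i in \<open>auto simp: mixed_actions_def\<close>)
  then have supp: "set_pmf (Pi_pmf (agents G) undefined ?\<alpha>) \<subseteq> ?P"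
    by (fastforce simp: set_Pi_pmf[OF finite_agents] PiE_dflt_def)
  have prob: "pmf (Pi_pmf (agents G) undefined ?\<alpha>) f =
      pmf p (f i) * (\<Prod>j\<in>agents G - {i}. x (j, \<theta> j, f j))" if "f \<in> ?P" for f
  proof -
    have "pmf (Pi_pmf (agents G) undefined ?\<alpha>) f = (\<Prod>j\<in>agents G. pmf (?\<alpha> j) (f j))"
      using that by (intro pmf_Pi' finite_agents) (auto simp: PiE_dflt_def)
    also have "\<dots> = pmf p (f i) * (\<Prod>j\<in>agents G - {i}. pmf (?\<alpha> j) (f j))"
      using \<alpha>_i by (subst prod.remove[OF finite_agents i]) simp
    also have "(\<Prod>j\<in>agents G - {i}. pmf (?\<alpha> j) (f j)) = (\<Prod>j\<in>agents G - {i}. x (j, \<theta> j, f j))"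
    proof (intro prod.cong refl)
      fix j assume j: "j \<in> agents G - {i}"
      then have "\<theta> j \<in> type_space G j" "f j \<in> actions G j"
        using \<theta> that by (auto simp: PiE_dflt_def PiE_iff)
      then show "pmf (?\<alpha> j) (f j) = x (j, \<theta> j, f j)"
        using j \<alpha>[OF j] pmf_strategy_profile[OF x] by simp
    qed
    finally show ?thesis .
  qed
  have "expected_utility G i ?\<alpha> t = (\<Sum>f\<in>?P. pmf (Pi_pmf (agents G) undefined ?\<alpha>) f * utility G i f t)"
    unfolding expected_utility_def using supp
    by (subst integral_measure_pmf[OF finite_pure_profiles]) auto
  also have "\<dots> = (\<Sum>f\<in>?P. pmf p (f i) * ((\<Prod>j\<in>agents G - {i}. x (j, \<theta> j, f j)) * utility G i f t))"
    by (intro sum.cong refl) (simp add: prob mult.assoc)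
  also have "\<dots> = (\<Sum>b\<in>actions G i. \<Sum>f | f \<in> ?P \<and> f i = b.
      pmf p (f i) * ((\<Prod>j\<in>agents G - {i}. x (j, \<theta> j, f j)) * utility G i f t))"
    using i by (intro sum.group[symmetric] finite_pure_profiles finite_actions) (auto simp: PiE_dflt_def)
  also have "\<dots> = (\<Sum>b\<in>actions G i. pmf p b * pure_payoff G i t x \<theta> b)"
    unfolding pure_payoff_def sum_distrib_left by (intro sum.cong refl) auto
  finally show ?thesis .
qed

text \<open>The payoff is an average of pure payoffs, so the supremum over deviations is attained at
  a point mass on a best pure action.\<close>

lemma regret_strategy_profile:
  assumes x: "x \<in> strategy_vectors G" and i: "i \<in> agents G" and t: "t \<in> type_space G i"
    and s: "s \<in> mixed_strategies G i" and \<theta>: "\<theta> \<in> PiE (agents G - {i}) (type_space G)"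
    and y: "\<And>b. b \<in> actions G i \<Longrightarrow> y (i, t, b) = pmf (s t) b"
  shows "regret G i s t \<theta> (restrict (strategy_profile G x) (agents G - {i})) = regret_vec G i t x y \<theta>"
proof -
  let ?v = "pure_payoff G i t x \<theta>"
  let ?U = "\<lambda>s. \<Sum>b\<in>actions G i. pmf (s t) b * ?v b"
  have U: "expected_utility G i (play G i (s' t) (restrict (strategy_profile G x) (agents G - {i})) \<theta>) t = ?U s'"
    if "s' \<in> mixed_strategies G i" for s'
    using that t by (intro expected_utility_strategy_profile x i \<theta>) (auto simp: mixed_strategies_def)
  have "Max (?v ` actions G i) \<in> ?v ` actions G i"
    using i by (intro Max_in) (auto simp: finite_actions actions_nonempty)
  then obtain b where b: "b \<in> actions G i" "?v b = Max (?v ` actions G i)" by force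
  \<comment> \<open>Only the value at \<open>t\<close> counts; the same action is used at every type
    merely to obtain a member of \<open>mixed_strategies G i\<close>.\<close>
  define best where "best = (\<lambda>t\<in>type_space G i. return_pmf b)"
  have best: "best \<in> mixed_strategies G i"
    using b by (auto simp: best_def mixed_strategies_def mixed_actions_def)
  have U_best: "?U best = Max (?v ` actions G i)"
    using b i t by (simp add: best_def pmf_return indicator_def if_distrib[of "\<lambda>c. c * _"] finite_actions cong: if_cong)
  have U_le: "?U s' \<le> Max (?v ` actions G i)" if "s' \<in> mixed_strategies G i" for s'
  proof -
    have "?U s' \<le> (\<Sum>b\<in>actions G i. pmf (s' t) b * Max (?v ` actions G i))"
      using i by (intro sum_mono mult_left_mono) (auto simp: finite_actions)
    also have "\<dots> = Max (?v ` actions G i)"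
      using sum_pmf_eq_1[OF finite_actions[OF i], of "s' t"] that t
      by (auto simp: sum_distrib_right[symmetric] mixed_strategies_def mixed_actions_def)
    finally show ?thesis .
  qed
  have "regret G i s t \<theta> (restrict (strategy_profile G x) (agents G - {i})) =
      (SUP s'\<in>mixed_strategies G i. ?U s' - ?U s)"
    unfolding regret_def by (intro SUP_cong refl) (simp add: U s)
  also have "\<dots> = Max (?v ` actions G i) - ?U s"
    using U_le by (intro cSup_eq_maximum) (auto simp: U_best[symmetric] intro!: image_eqI[OF _ best])
  also have "\<dots> = regret_vec G i t x y \<theta>"
    by (simp add: regret_vec_def y)
  finally show ?thesis .
qed

lemma max_regret_strategy_profile:
  assumes "x \<in> strategy_vectors G" "i \<in> agents G" "t \<in> type_space G i" "s \<in> mixed_strategies G i"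
    and "\<And>b. b \<in> actions G i \<Longrightarrow> y (i, t, b) = pmf (s t) b"
  shows "max_regret G i s t (restrict (strategy_profile G x) (agents G - {i})) = max_regret_vec G i t x y"
proof (cases "compatible_types G i t = {}")
  case False
  have "(SUP \<theta>\<in>compatible_types G i t. regret G i s t \<theta> (restrict (strategy_profile G x) (agents G - {i})))
      = Sup (regret_vec G i t x y ` compatible_types G i t)"
    by (intro SUP_cong refl regret_strategy_profile assms) (simp_all add: compatible_types_def)
  with False show ?thesis
    by (simp add: max_regret_def max_regret_vec_def cSup_eq_Max finite_compatible_types)
qed (simp add: max_regret_def max_regret_vec_def)

section \<open>Continuity and convexity of max regret\<close>

text \<open>The map \<open>g\<close> covers both uses: the identity for \<open>x\<close> against
  itself, and a constant for a fixed deviation.\<close>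

lemma continuous_on_max_regret_vec:
  assumes i: "i \<in> agents G" and g: "continuous_on S g"
  shows "continuous_on S (\<lambda>x. max_regret_vec G i t x (g x))"
proof (cases "compatible_types G i t = {}")
  case False
  have coord: "continuous_on S (\<lambda>x. x k)" for k
    by (rule continuous_on_subset[OF continuous_on_product_coordinates subset_UNIV])
  have g_coord: "continuous_on S (\<lambda>x. g x k)" for k
    using continuous_on_product_then_coordinatewise[OF g] .
  have payoff: "continuous_on S (\<lambda>x. pure_payoff G i t x \<theta> b)" for \<theta> b
    unfolding pure_payoff_def
    by (intro continuous_on_sum continuous_on_mult_right continuous_on_prod coord)
  have "continuous_on S (\<lambda>x. regret_vec G i t x (g x) \<theta>)" for \<theta>
    unfolding regret_vec_def using i
    by (intro continuous_on_diff continuous_on_sum continuous_on_mult g_coord payoff continuous_on_Max_image)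
      (auto simp: finite_actions actions_nonempty)
  then have "continuous_on S (\<lambda>x. Max ((\<lambda>\<theta>. regret_vec G i t x (g x) \<theta>) ` compatible_types G i t))"
    using False by (intro continuous_on_Max_image finite_compatible_types)
  with False show ?thesis by (simp add: max_regret_vec_def)
qed (simp add: max_regret_vec_def)

text \<open>For fixed \<open>\<theta>\<close> the regret is affine in the agent's own play, and a
  maximum of affine functions is convex.\<close>

lemma max_regret_vec_convex:
  fixes c :: "nat \<Rightarrow> real"
  assumes c: "\<And>k. k < n \<Longrightarrow> 0 \<le> c k" "sum c {..<n} = 1"
  shows "max_regret_vec G i t x (\<lambda>j. \<Sum>k<n. c k * y k j) \<le> (\<Sum>k<n. c k * max_regret_vec G i t x (y k))"
proof (cases "compatible_types G i t = {}")
  case False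
  have "regret_vec G i t x (\<lambda>j. \<Sum>k<n. c k * y k j) \<theta> \<le> (\<Sum>k<n. c k * max_regret_vec G i t x (y k))"
    if \<theta>: "\<theta> \<in> compatible_types G i t" for \<theta>
  proof -
    let ?v = "pure_payoff G i t x \<theta>" and ?A = "actions G i"
    \<comment> \<open>The best pure payoff is multiplied by the total weight 1 so that it can be
      distributed over the combination.\<close>
    have "regret_vec G i t x (\<lambda>j. \<Sum>k<n. c k * y k j) \<theta> =
        sum c {..<n} * Max (?v ` ?A) - (\<Sum>b\<in>?A. \<Sum>k<n. c k * y k (i, t, b) * ?v b)"
      using c(2) by (simp add: regret_vec_def sum_distrib_right)
    also have "\<dots> = (\<Sum>k<n. c k * regret_vec G i t x (y k) \<theta>)"
      by (subst sum.swap)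
        (simp add: regret_vec_def sum_distrib_right sum_distrib_left right_diff_distrib sum_subtractf mult.assoc)
    also have "\<dots> \<le> (\<Sum>k<n. c k * max_regret_vec G i t x (y k))"
      using c(1) \<theta> False finite_compatible_types
      by (intro sum_mono mult_left_mono) (auto simp: max_regret_vec_def)
    finally show ?thesis .
  qed
  then show ?thesis
    using False finite_compatible_types
    by (subst max_regret_vec_def) auto
qed (simp add: max_regret_vec_def)

section \<open>The convex compact set of strategy vectors\<close>

lemma compact_strategy_vectors: "compact (strategy_vectors G)"
proof -
  have coord: "continuous_on UNIV (\<lambda>x. x k)" for k :: "'i \<times> 't \<times> 'a"
    by (rule continuous_on_product_coordinates)
  have "closed (\<Inter>i\<in>agents G. \<Inter>t\<in>type_space G i.
      {x :: 'i \<times> 't \<times> 'a \<Rightarrow> real. (\<Sum>a\<in>actions G i. x (i, t, a)) = 1})"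
    by (intro closed_INT ballI closed_Collect_eq continuous_on_sum coord continuous_on_const)
  then have "compact ({x. \<forall>k. x k \<in> {0..1}} \<inter> (\<Inter>i\<in>agents G. \<Inter>t\<in>type_space G i.
      {x :: 'i \<times> 't \<times> 'a \<Rightarrow> real. (\<Sum>a\<in>actions G i. x (i, t, a)) = 1}))"
    using compact_Int_closed[OF compact_cube_fun] by blast
  also have "\<dots> = strategy_vectors G"
    by (auto simp: strategy_vectors_def)
  finally show ?thesis .
qed

lemma strategy_vectors_nonempty: "strategy_vectors G \<noteq> {}"
proof -
  \<comment> \<open>Uniform mixing. Off the agents the cardinality may be 0, and the quotient is
    then 0, still in \<open>{0..1}\<close>.\<close>
  have "(\<lambda>(i, t, a). 1 / real (card (actions G i))) \<in> strategy_vectors G"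
    using finite_actions actions_nonempty by (auto simp: strategy_vectors_def divide_simps)
  then show ?thesis by blast
qed

lemma strategy_vectors_convex:
  assumes y: "\<And>k. k < n \<Longrightarrow> y k \<in> strategy_vectors G"
    and c: "\<And>k. k < n \<Longrightarrow> 0 \<le> c k" "sum c {..<n} = 1"
  shows "(\<lambda>j. \<Sum>k<n. c k * y k j) \<in> strategy_vectors G"
proof -
  note range = strategy_vectors_nonneg[OF y] strategy_vectors_le_1[OF y]
  have "(\<Sum>k<n. c k * y k j) \<le> (\<Sum>k<n. c k * 1)" for j
    using range c(1) by (intro sum_mono mult_left_mono) auto
  moreover have "0 \<le> (\<Sum>k<n. c k * y k j)" for j
    using range c(1) by (intro sum_nonneg mult_nonneg_nonneg) auto
  moreover have "(\<Sum>a\<in>actions G i. \<Sum>k<n. c k * y k (i, t, a)) = 1"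
    if "i \<in> agents G" "t \<in> type_space G i" for i t
  proof -
    have "(\<Sum>a\<in>actions G i. \<Sum>k<n. c k * y k (i, t, a)) = (\<Sum>k<n. c k * (\<Sum>a\<in>actions G i. y k (i, t, a)))"
      by (subst sum.swap) (simp add: sum_distrib_left)
    also have "\<dots> = (\<Sum>k<n. c k * 1)"
      using y that by (intro sum.cong refl) (auto simp: strategy_vectors_def)
    finally show ?thesis using c(2) by simp
  qed
  ultimately show ?thesis using c(2) by (simp add: strategy_vectors_def)
qed

section \<open>Equilibrium from Ky Fan's inequality\<close>

text \<open>Summing the drops in max regret over all agents and types produces one function, so that
  a single \<open>x\<close> serves every agent and type at once.\<close>

lemma ex_no_profitable_change:
  "\<exists>x\<in>strategy_vectors G. \<forall>y\<in>strategy_vectors G.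
     (\<Sum>i\<in>agents G. \<Sum>t\<in>type_space G i. max_regret_vec G i t x x - max_regret_vec G i t x y) \<le> 0"
proof (rule Ky_Fan[OF compact_strategy_vectors strategy_vectors_nonempty])
  show "continuous_on (strategy_vectors G) (\<lambda>x. \<Sum>i\<in>agents G. \<Sum>t\<in>type_space G i.
      max_regret_vec G i t x x - max_regret_vec G i t x y)" for y
    by (intro continuous_on_sum continuous_on_diff continuous_on_max_regret_vec continuous_on_id continuous_on_const)
next
  fix n :: nat and c :: "nat \<Rightarrow> real" and y :: "nat \<Rightarrow> 'i \<times> 't \<times> 'a \<Rightarrow> real" and x
  assume c: "\<And>k. k < n \<Longrightarrow> 0 \<le> c k" "sum c {..<n} = 1"
  have "(\<Sum>k<n. c k * (\<Sum>i\<in>agents G. \<Sum>t\<in>type_space G i. max_regret_vec G i t x x - max_regret_vec G i t x (y k))) =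
      (\<Sum>i\<in>agents G. \<Sum>t\<in>type_space G i. \<Sum>k<n. c k * (max_regret_vec G i t x x - max_regret_vec G i t x (y k)))"
    unfolding sum_distrib_left by (subst sum.swap) (intro sum.cong refl sum.swap)
  also have "\<dots> = (\<Sum>i\<in>agents G. \<Sum>t\<in>type_space G i.
      max_regret_vec G i t x x - (\<Sum>k<n. c k * max_regret_vec G i t x (y k)))"
    using c(2) by (simp add: right_diff_distrib sum_subtractf sum_distrib_right[symmetric])
  also have "\<dots> \<le> (\<Sum>i\<in>agents G. \<Sum>t\<in>type_space G i.
      max_regret_vec G i t x x - max_regret_vec G i t x (\<lambda>j. \<Sum>k<n. c k * y k j))"
    using max_regret_vec_convex[OF c] by (intro sum_mono diff_left_mono) auto
  finally show "(\<Sum>k<n. c k * (\<Sum>i\<in>agents G. \<Sum>t\<in>type_space G i. max_regret_vec G i t x x - max_regret_vec G i t x (y k)))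
      \<le> (\<Sum>i\<in>agents G. \<Sum>t\<in>type_space G i.
      max_regret_vec G i t x x - max_regret_vec G i t x (\<lambda>j. \<Sum>k<n. c k * y k j))" .
qed (auto intro: strategy_vectors_convex)

lemma ex_minimax_regret_equilibrium: "\<exists>\<sigma>. minimax_regret_equilibrium G \<sigma>"
proof -
  obtain x where x: "x \<in> strategy_vectors G"
    and opt: "\<And>y. y \<in> strategy_vectors G \<Longrightarrow>
      (\<Sum>i\<in>agents G. \<Sum>t\<in>type_space G i. max_regret_vec G i t x x - max_regret_vec G i t x y) \<le> 0"
    using ex_no_profitable_change by blast
  let ?\<sigma> = "strategy_profile G x"
  have mixed: "?\<sigma> i \<in> mixed_strategies G i" if "i \<in> agents G" for i
    using strategy_profile_mixed[OF x] that by (auto simp: PiE_iff)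
  have best: "max_regret G i (?\<sigma> i) t (restrict ?\<sigma> (agents G - {i})) \<le>
      max_regret G i s t (restrict ?\<sigma> (agents G - {i}))"
    if i: "i \<in> agents G" and t: "t \<in> type_space G i" and s: "s \<in> mixed_strategies G i" for i t s
  proof -
    \<comment> \<open>The deviation to \<open>s\<close> is made at agent \<open>i\<close> and type
      \<open>t\<close> only. All other summands then vanish, and the bound on the total becomes the
      bound for this agent and type.\<close>
    define y where "y = (\<lambda>(j, t', a). if j = i \<and> t' = t then pmf (s t) a else x (j, t', a))"
    have "(\<Sum>a\<in>actions G i. pmf (s t) a) = 1"
      using s t by (intro sum_pmf_eq_1 finite_actions i) (auto simp: mixed_strategies_def mixed_actions_def)
    then have "(\<Sum>a\<in>actions G j. y (j, t', a)) = 1" if "j \<in> agents G" "t' \<in> type_space G j" for j t'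
      using x that by (cases "j = i \<and> t' = t") (auto simp: strategy_vectors_def y_def)
    moreover have "y k \<in> {0..1}" for k
      using strategy_vectors_nonneg[OF x] strategy_vectors_le_1[OF x]
      by (auto simp: y_def pmf_le_1 split: prod.splits)
    ultimately have "y \<in> strategy_vectors G"
      by (simp add: strategy_vectors_def)
    then have "(\<Sum>j\<in>agents G. \<Sum>t'\<in>type_space G j. max_regret_vec G j t' x x - max_regret_vec G j t' x y) \<le> 0"
      by (rule opt)
    also have "(\<Sum>j\<in>agents G. \<Sum>t'\<in>type_space G j. max_regret_vec G j t' x x - max_regret_vec G j t' x y) =
        (\<Sum>j\<in>agents G. \<Sum>t'\<in>type_space G j. if j = i \<and> t' = t
          then max_regret_vec G i t x x - max_regret_vec G i t x y else 0)"
    proof (intro sum.cong refl)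
      fix j t'
      show "max_regret_vec G j t' x x - max_regret_vec G j t' x y = (if j = i \<and> t' = t
          then max_regret_vec G i t x x - max_regret_vec G i t x y else 0)"
        using max_regret_vec_cong[of G j y t' x x] by (auto simp: y_def)
    qed
    also have "\<dots> = (\<Sum>j\<in>agents G. if j = i then max_regret_vec G i t x x - max_regret_vec G i t x y else 0)"
      using t finite_types[OF i] by (intro sum.cong refl) auto
    also have "\<dots> = max_regret_vec G i t x x - max_regret_vec G i t x y"
      using i finite_agents by simp
    also have "max_regret_vec G i t x x = max_regret G i (?\<sigma> i) t (restrict ?\<sigma> (agents G - {i}))"
      by (intro max_regret_strategy_profile[symmetric] x i t mixed) (simp add: pmf_strategy_profile x i t)
    also have "max_regret_vec G i t x y = max_regret G i s t (restrict ?\<sigma> (agents G - {i}))"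
      by (intro max_regret_strategy_profile[symmetric] x i t s) (simp add: y_def)
    finally show ?thesis by (simp only: diff_le_0_iff_le)
  qed
  have "minimax_regret_equilibrium G ?\<sigma>"
    using strategy_profile_mixed[OF x] mixed best
    by (auto simp: minimax_regret_equilibrium_def minimax_best_response_def is_arg_min_def not_less)
  then show ?thesis by blast
qed

end

theorem theorem1:
  fixes G :: "('i, 'a, 't) game"
  assumes "strict_type_game G"
    and "finite_game G"
  shows "\<exists>\<sigma>. minimax_regret_equilibrium G \<sigma>"
  using assms(2) by (rule ex_minimax_regret_equilibrium)

end
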